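(* Let $(F,X,\mu)$ be an ergodic dynamical system, with $X$ a Riemannian manifold of dimension $D$ and $\mu$ an $F$-invariant probability measure. Let $B_1$ and $B_2$ be Banach spaces (of functions on $X$) and suppose $(F,X,\mu)$ has exponential decay of correlations for $B_1$ versus $B_2$: there are $C>0$ and $0<\theta<1$ such that $$\left|\int f\cdot g\circ F^n\,d\mu-\mu(f)\mu(g)\right|\le C\theta^n\|f\|_{B_1}\|g\|_{B_2},\qquad n\ge0,$$ for $f\in B_1$, $g\in B_2$. Let $\phi$ be an observable on $(X,\mu)$ with stable index $\alpha\in(1,2)$. Let $\epsilon>0$, and put $\psi_n:=\phi\,\mathbf 1_{\{|\phi|<n^{1/\alpha+\epsilon}\}}$ and $\bar\psi_n:=\psi_n-\mu(\psi_n)$. Assume there exist approximations $f_n$ to $\bar\psi_n$, with $f_n\in B_i$ for $i=1,2$, such that for some constant $C>0$: (a) $\|\bar\psi_n-f_n\|_{L^1(\mu)}<Cn^{-4-\frac1\alpha}$; (b) $\|f_n\|_{B_i}<Cn^{\kappa}$ ($i=1,2$) for some $\kappa>0$; (c) $\|f_n\|_\infty\le C\|\bar\psi_n\|_\infty$; (d) $\mu(f_n)=0$. Then $$\frac{1}{n^{1/\alpha+\epsilon}}\max_{j\le n}\sum_{i=1}^j\left[\phi\circ F^i-\mu(\phi)\right]\xrightarrow{d}0.$$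
   Context: Write $\mu(f)=\int f\,d\mu$. An observable $\phi:X\to\mathbb R$ has stable index $\alpha$ if $\mu(|\phi|>x)=x^{-\alpha}L(x)$ for a slowly varying function $L$ and $\lim_{x\to\infty}\mu(\phi>x)/\mu(|\phi|>x)=p$ for some $0\le p\le1$. The constants $C,\kappa$ in (a)-(c) do not depend on $n$ (the $f_n$ may depend on $\epsilon$). $\xrightarrow{d}$ denotes convergence in distribution with respect to $\mu$. *)

theory Defs
  imports "HOL-Probability.Probability"
begin

section \<open>Riemannian manifolds\<close>

fun Ck_on :: "nat \<Rightarrow> 'e::euclidean_space set \<Rightarrow> ('e \<Rightarrow> 'b::real_normed_vector) \<Rightarrow> bool" where
  "Ck_on 0 S f \<longleftrightarrow> continuous_on S f"
| "Ck_on (Suc k) S f \<longleftrightarrow>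
     f differentiable_on S \<and> (\<forall>v\<in>Basis. Ck_on k S (\<lambda>x. frechet_derivative f (at x) v))"

text \<open>\<open>smooth_on S f\<close> is only meant for open \<open>S\<close>.\<close>

definition smooth_on :: "'e::euclidean_space set \<Rightarrow> ('e \<Rightarrow> 'b::real_normed_vector) \<Rightarrow> bool" where
  "smooth_on S f \<longleftrightarrow> (\<forall>k. Ck_on k S f)"

text \<open>A chart is a pair \<open>(U, c)\<close> of an open domain \<open>U\<close> and a coordinate map, which is only
  relevant on \<open>U\<close>. The dimension of the manifold is \<open>DIM('e)\<close>; the Hausdorff property and second
  countability are the type classes of \<open>'x\<close>.\<close>

type_synonym ('x, 'e) chart = "'x set \<times> ('x \<Rightarrow> 'e)"

definition coord_change :: "('x, 'e) chart \<Rightarrow> ('x, 'e) chart \<Rightarrow> 'e \<Rightarrow> 'e" where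
  "coord_change p q = snd q \<circ> inv_into (fst p) (snd p)"

definition smooth_atlas ::
  "('x::{t2_space, second_countable_topology}, 'e::euclidean_space) chart set \<Rightarrow> bool" where
  "smooth_atlas A \<longleftrightarrow>
     (\<forall>(U, c)\<in>A. open U \<and> open (c ` U) \<and> homeomorphism U (c ` U) c (inv_into U c)) \<and>
     (\<Union>p\<in>A. fst p) = UNIV \<and>
     (\<forall>p\<in>A. \<forall>q\<in>A. smooth_on (snd p ` (fst p \<inter> fst q)) (coord_change p q))"

text \<open>\<open>g p x v w\<close> is the inner product at \<open>x\<close> of the tangent vectors having components \<open>v\<close> and
  \<open>w\<close> in the chart \<open>p\<close>. The last clause is the transformation law of a covariant 2-tensor.\<close>

definition riemannian_metric ::
  "('x::{t2_space, second_countable_topology}, 'e::euclidean_space) chart set \<Rightarrow>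
   (('x, 'e) chart \<Rightarrow> 'x \<Rightarrow> 'e \<Rightarrow> 'e \<Rightarrow> real) \<Rightarrow> bool" where
  "riemannian_metric A g \<longleftrightarrow>
     (\<forall>p\<in>A. \<forall>x\<in>fst p. bilinear (g p x) \<and> (\<forall>v w. g p x v w = g p x w v) \<and>
        (\<forall>v. v \<noteq> 0 \<longrightarrow> g p x v v > 0)) \<and>
     (\<forall>p\<in>A. \<forall>v w. smooth_on (snd p ` fst p) (\<lambda>y. g p (inv_into (fst p) (snd p) y) v w)) \<and>
     (\<forall>p\<in>A. \<forall>q\<in>A. \<forall>x\<in>fst p \<inter> fst q. \<forall>v w.
        let T = frechet_derivative (coord_change p q) (at (snd p x))
        in g p x v w = g q x (T v) (T w))"

definition riemannian_manifold ::
  "('x::{t2_space, second_countable_topology}, 'e::euclidean_space) chart set \<Rightarrow>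
   (('x, 'e) chart \<Rightarrow> 'x \<Rightarrow> 'e \<Rightarrow> 'e \<Rightarrow> real) \<Rightarrow> bool" where
  "riemannian_manifold A g \<longleftrightarrow> smooth_atlas A \<and> riemannian_metric A g"

section \<open>Ergodic systems and decay of correlations\<close>

definition measure_preserving_map :: "'x measure \<Rightarrow> ('x \<Rightarrow> 'x) \<Rightarrow> bool" where
  "measure_preserving_map M F \<longleftrightarrow> F \<in> measurable M M \<and> distr M M F = M"

definition ergodic_system :: "'x measure \<Rightarrow> ('x \<Rightarrow> 'x) \<Rightarrow> bool" where
  "ergodic_system M F \<longleftrightarrow> prob_space M \<and> measure_preserving_map M F \<and>
     (\<forall>A\<in>sets M. F -` A \<inter> space M = A \<longrightarrow> measure M A = 0 \<or> measure M A = 1)"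

text \<open>A Banach space of functions on \<open>(X, \<mu>)\<close> is given by a linear space \<open>B\<close> of functions and a
  complete seminorm \<open>N\<close> on \<open>B\<close> whose kernel consists of \<open>\<mu>\<close>-null functions. This covers
  spaces of genuine functions (such as Hoelder spaces) as well as spaces of classes modulo \<open>\<mu>\<close>-null
  functions (such as Lebesgue spaces or BV), where \<open>B\<close> is the set of all representatives.\<close>

definition banach_function_space ::
  "'x measure \<Rightarrow> ('x \<Rightarrow> real) set \<Rightarrow> (('x \<Rightarrow> real) \<Rightarrow> real) \<Rightarrow> bool" where
  "banach_function_space M B N \<longleftrightarrow>
     (\<lambda>x. 0) \<in> B \<and>
     (\<forall>f\<in>B. \<forall>g\<in>B. (\<lambda>x. f x + g x) \<in> B \<and> N (\<lambda>x. f x + g x) \<le> N f + N g) \<and>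
     (\<forall>a. \<forall>f\<in>B. (\<lambda>x. a * f x) \<in> B \<and> N (\<lambda>x. a * f x) = \<bar>a\<bar> * N f) \<and>
     (\<forall>f\<in>B. N f \<ge> 0 \<and> (N f = 0 \<longrightarrow> (AE x in M. f x = 0))) \<and>
     (\<forall>u. (\<forall>n. u n \<in> B) \<and>
          (\<forall>e>0. \<exists>n0. \<forall>m\<ge>n0. \<forall>n\<ge>n0. N (\<lambda>x. u m x - u n x) < e) \<longrightarrow>
          (\<exists>f\<in>B. (\<lambda>n. N (\<lambda>x. u n x - f x)) \<longlonglongrightarrow> 0))"

text \<open>The integrability clauses say that the integrals in the estimate exist (in the library a
  non-integrable function has integral 0).\<close>

definition exp_decay_of_correlations ::
  "'x measure \<Rightarrow> ('x \<Rightarrow> 'x) \<Rightarrow> ('x \<Rightarrow> real) set \<Rightarrow> (('x \<Rightarrow> real) \<Rightarrow> real) \<Rightarrow>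
   ('x \<Rightarrow> real) set \<Rightarrow> (('x \<Rightarrow> real) \<Rightarrow> real) \<Rightarrow> bool" where
  "exp_decay_of_correlations M F B1 N1 B2 N2 \<longleftrightarrow>
     (\<exists>C \<theta>. C > 0 \<and> 0 < \<theta> \<and> \<theta> < 1 \<and>
        (\<forall>f\<in>B1. \<forall>g\<in>B2. \<forall>n.
           integrable M f \<and> integrable M g \<and> integrable M (\<lambda>x. f x * g ((F ^^ n) x)) \<and>
           \<bar>(LINT x|M. f x * g ((F ^^ n) x)) - (LINT x|M. f x) * (LINT x|M. g x)\<bar>
             \<le> C * \<theta> ^ n * N1 f * N2 g))"

section \<open>Stable index and truncation\<close>

definition slowly_varying :: "(real \<Rightarrow> real) \<Rightarrow> bool" where
  "slowly_varying L \<longleftrightarrow> L \<in> borel_measurable borel \<and> (\<forall>\<^sub>F x in at_top. L x > 0) \<and>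
     (\<forall>c>0. ((\<lambda>x. L (c * x) / L x) \<longlongrightarrow> 1) at_top)"

definition has_stable_index :: "'x measure \<Rightarrow> ('x \<Rightarrow> real) \<Rightarrow> real \<Rightarrow> bool" where
  "has_stable_index M \<phi> \<alpha> \<longleftrightarrow> \<phi> \<in> borel_measurable M \<and>
     (\<exists>L. slowly_varying L \<and>
        (\<forall>x>0. measure M {y \<in> space M. \<bar>\<phi> y\<bar> > x} = x powr (-\<alpha>) * L x)) \<and>
     (\<exists>p. 0 \<le> p \<and> p \<le> 1 \<and>
        ((\<lambda>x. measure M {y \<in> space M. \<phi> y > x} / measure M {y \<in> space M. \<bar>\<phi> y\<bar> > x}) \<longlongrightarrow> p) at_top)"

definition truncation :: "('x \<Rightarrow> real) \<Rightarrow> real \<Rightarrow> real \<Rightarrow> nat \<Rightarrow> 'x \<Rightarrow> real" where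
  "truncation \<phi> \<alpha> \<epsilon> n = (\<lambda>x. \<phi> x * indicator {y. \<bar>\<phi> y\<bar> < real n powr (1 / \<alpha> + \<epsilon>)} x)"

definition centred_truncation ::
  "'x measure \<Rightarrow> ('x \<Rightarrow> real) \<Rightarrow> real \<Rightarrow> real \<Rightarrow> nat \<Rightarrow> 'x \<Rightarrow> real" where
  "centred_truncation M \<phi> \<alpha> \<epsilon> n =
     (\<lambda>x. truncation \<phi> \<alpha> \<epsilon> n x - (LINT y|M. truncation \<phi> \<alpha> \<epsilon> n y))"

definition L1_norm :: "'x measure \<Rightarrow> ('x \<Rightarrow> real) \<Rightarrow> ennreal" where
  "L1_norm M f = (\<integral>\<^sup>+ x. ennreal \<bar>f x\<bar> \<partial>M)"

definition Linf_norm :: "'x measure \<Rightarrow> ('x \<Rightarrow> real) \<Rightarrow> ereal" where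
  "Linf_norm M f = esssup M (\<lambda>x. ereal \<bar>f x\<bar>)"

text \<open>Convergence in distribution, with respect to \<open>M\<close>, to a constant.\<close>

definition converges_in_distribution_to_const ::
  "'x measure \<Rightarrow> (nat \<Rightarrow> 'x \<Rightarrow> real) \<Rightarrow> real \<Rightarrow> bool" where
  "converges_in_distribution_to_const M Y a \<longleftrightarrow>
     weak_conv_m (\<lambda>n. distr M borel (Y n)) (return borel a)"

end

theory Submission
  imports Defs "HOL-Real_Asymp.Real_Asymp"
begin

text \<open>
  Put \<open>p = 1/\<alpha> + \<epsilon>\<close> and \<open>b = n powr p\<close>. Since \<open>p * \<alpha> > 1\<close>, one can choose \<open>s\<close> with
  \<open>1 < s < \<alpha>\<close> and \<open>p * s > 1\<close>. The only consequence of the stable index that matters is that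
  \<open>\<phi>\<close> has a finite moment of order \<open>s\<close> (\<open>stable_index_moment\<close>): a slowly varying factor in the tail
  costs less than any power. This turns every truncation estimate into a power of \<open>b\<close>, and
  \<open>n * b powr (-s) = n powr (1 - p * s)\<close> leaves a genuine negative power of \<open>n\<close>, against which all
  logarithmic losses below are negligible.

  Write \<open>\<phi> - \<mu>(\<phi>) = f + r\<close>, where \<open>f\<close> is the approximation of the centred truncation. The
  remainder \<open>r\<close> collects the part of \<open>\<phi>\<close> above level \<open>b\<close>, the difference of the two means and the
  approximation error. It is so small in \<open>L\<^sup>1\<close> that the maximum of its partial sums may be replaced by
  the sum of \<open>\<bar>r\<bar>\<close> along \<open>n\<close> steps of the orbit, whose mean is \<open>n * \<mu>(\<bar>r\<bar>)\<close> by invariance.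

  For \<open>f\<close> cancellation is needed. The correlations of \<open>f\<close> along the orbit are at most \<open>\<mu>(f\<^sup>2)\<close>, whose
  main part is of order \<open>b powr (2 - s)\<close>, and the decay of correlations makes them smaller than any
  prescribed power of \<open>n\<close> at lags beyond \<open>h\<close>, a suitable multiple of \<open>ln n\<close>: exponential decay beats
  the polynomial growth of the norms of \<open>f\<close>. So a block of \<open>N\<close> consecutive terms has second
  moment at most about \<open>N * h * \<mu>(f\<^sup>2)\<close> (\<open>second_moment_sum_le\<close>), and the dyadic chaining argument of
  Rademacher and Menshov (\<open>rademacher_menshov\<close>) converts this into a bound for the maximum of the
  partial sums at the price of another logarithm.

  Together these bounds (\<open>truncated_maximal_inequality\<close>, \<open>normalised_bound_le\<close>) show that the
  normalised maximum tends to 0 in \<open>L\<^sup>1\<close>, which is stronger than convergence to 0 in distribution.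
\<close>

section \<open>Dyadic maximal inequality\<close>

text \<open>
  The sum of the squared increments of \<open>S\<close> over all dyadic subintervals of \<open>[a, a + 2 ^ m]\<close>, from
  the whole interval down to unit length.
\<close>

fun dyadic_energy :: "(nat \<Rightarrow> real) \<Rightarrow> nat \<Rightarrow> nat \<Rightarrow> real" where
  "dyadic_energy S 0 a = (S (a + 1) - S a)\<^sup>2"
| "dyadic_energy S (Suc m) a =
     (S (a + 2 ^ Suc m) - S a)\<^sup>2 + dyadic_energy S m a + dyadic_energy S m (a + 2 ^ m)"

lemma dyadic_energy_nonneg: "0 \<le> dyadic_energy S m a"
  by (induction m arbitrary: a) auto

lemma square_increment_le_dyadic_energy: "(S (a + 2 ^ m) - S a)\<^sup>2 \<le> dyadic_energy S m a"
  by (cases m) (auto simp: dyadic_energy_nonneg)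

text \<open>
  The weight \<open>t\<close> lets the induction below absorb one increment of a longer dyadic interval while the
  constant grows only from \<open>t\<close> to \<open>t + 1\<close>; equal weights would double it at each level.
\<close>

lemma square_sum_le_weighted:
  fixes x y t :: real
  assumes "t > 0"
  shows "(x + y)\<^sup>2 \<le> (t + 1) * (x\<^sup>2 + y\<^sup>2 / t)"
proof -
  have "(t + 1) * (x\<^sup>2 + y\<^sup>2 / t) - (x + y)\<^sup>2 = (t * x - y)\<^sup>2 / t"
    using assms by (simp add: power2_eq_square field_simps)
  also have "\<dots> \<ge> 0" using assms by simp
  finally show ?thesis by simp
qed

text \<open>
  Every \<open>j \<le> 2 ^ m\<close> is reached from 0 by at most one dyadic step of each length, so Cauchy--Schwarz
  over the \<open>m + 1\<close> lengths gives the factor. The bound on the right does not depend on \<open>j\<close>, which is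
  what makes it a maximal inequality.
\<close>

lemma increment_le_dyadic_energy:
  assumes "j \<le> 2 ^ m"
  shows "(S (a + j) - S a)\<^sup>2 \<le> real (m + 1) * dyadic_energy S m a"
  using assms
proof (induction m arbitrary: a j)
  case 0
  then have "j = 0 \<or> j = 1" by auto
  then show ?case by auto
next
  case (Suc m)
  let ?E = "dyadic_energy S m a" and ?E' = "dyadic_energy S m (a + 2 ^ m)"
  have nn: "0 \<le> ?E" "0 \<le> ?E'" by (rule dyadic_energy_nonneg)+
  have "(S (a + j) - S a)\<^sup>2 \<le> real (m + 2) * (?E + ?E')"
  proof (cases "j \<le> 2 ^ m")
    case True
    then have "(S (a + j) - S a)\<^sup>2 \<le> real (m + 1) * ?E" by (rule Suc.IH)
    also have "\<dots> \<le> real (m + 2) * (?E + ?E')"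
      using nn by (intro mult_mono) auto
    finally show ?thesis .
  next
    case False
    define i where "i = j - 2 ^ m"
    have i: "i \<le> 2 ^ m" and j: "a + j = (a + 2 ^ m) + i"
      using False Suc.prems by (auto simp: i_def)
    define x where "x = S (a + 2 ^ m) - S a"
    define y where "y = S (a + j) - S (a + 2 ^ m)"
    have x: "x\<^sup>2 \<le> ?E"
      unfolding x_def by (rule square_increment_le_dyadic_energy)
    have "y\<^sup>2 \<le> real (m + 1) * ?E'"
      unfolding y_def j by (rule Suc.IH[OF i])
    then have y: "y\<^sup>2 / real (m + 1) \<le> ?E'"
      by (simp add: field_simps)
    have "(S (a + j) - S a)\<^sup>2 = (x + y)\<^sup>2" by (simp add: x_def y_def)
    also have "\<dots> \<le> (real (m + 1) + 1) * (x\<^sup>2 + y\<^sup>2 / real (m + 1))"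
      by (rule square_sum_le_weighted) simp
    also have "\<dots> \<le> (real (m + 1) + 1) * (?E + ?E')"
      using x y by (intro mult_left_mono add_mono) auto
    finally show ?thesis by (simp add: algebra_simps)
  qed
  also have "\<dots> \<le> real (m + 2) * dyadic_energy S (Suc m) a"
    by (intro mult_left_mono) auto
  finally show ?case by simp
qed

text \<open>
  Each of the \<open>m + 1\<close> lengths contributes intervals of total length \<open>2 ^ m\<close>, hence the same amount
  \<open>2 ^ m * v\<close>.
\<close>

lemma dyadic_energy_expectation:
  fixes S :: "nat \<Rightarrow> 'a \<Rightarrow> real"
  assumes int: "\<And>a l. l \<le> m \<Longrightarrow> integrable M (\<lambda>x. (S (a + 2 ^ l) x - S a x)\<^sup>2)"
    and le: "\<And>a l. l \<le> m \<Longrightarrow> (LINT x|M. (S (a + 2 ^ l) x - S a x)\<^sup>2) \<le> 2 ^ l * v"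
  shows "integrable M (\<lambda>x. dyadic_energy (\<lambda>j. S j x) m a) \<and>
    (LINT x|M. dyadic_energy (\<lambda>j. S j x) m a) \<le> real (m + 1) * 2 ^ m * v"
  using assms
proof (induction m arbitrary: a)
  case 0
  show ?case using "0.prems"(1)[of 0 a] "0.prems"(2)[of 0 a] by simp
next
  case (Suc m)
  have IH: "integrable M (\<lambda>x. dyadic_energy (\<lambda>j. S j x) m b)"
    "(LINT x|M. dyadic_energy (\<lambda>j. S j x) m b) \<le> real (m + 1) * 2 ^ m * v" for b
    using Suc.IH[of b] Suc.prems by auto
  have top: "integrable M (\<lambda>x. (S (a + 2 ^ Suc m) x - S a x)\<^sup>2)"
    "(LINT x|M. (S (a + 2 ^ Suc m) x - S a x)\<^sup>2) \<le> 2 ^ Suc m * v"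
    using Suc.prems(1)[of "Suc m" a] Suc.prems(2)[of "Suc m" a] by auto
  have "(LINT x|M. dyadic_energy (\<lambda>j. S j x) (Suc m) a) =
      (LINT x|M. (S (a + 2 ^ Suc m) x - S a x)\<^sup>2) +
      (LINT x|M. dyadic_energy (\<lambda>j. S j x) m a) +
      (LINT x|M. dyadic_energy (\<lambda>j. S j x) m (a + 2 ^ m))"
    unfolding dyadic_energy.simps using top(1) IH(1) by (simp del: power_Suc)
  also have "\<dots> \<le> 2 ^ Suc m * v + real (m + 1) * 2 ^ m * v + real (m + 1) * 2 ^ m * v"
    using top(2) IH(2) by (intro add_mono) auto
  also have "\<dots> = real (Suc m + 1) * 2 ^ Suc m * v"
    by (simp add: algebra_simps)
  finally show ?case
    unfolding dyadic_energy.simps using top(1) IH(1) by (simp del: power_Suc)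
qed

lemma (in prob_space) integrable_and_expectation_le_sqrt:
  fixes Z G :: "'a \<Rightarrow> real"
  assumes [measurable]: "Z \<in> borel_measurable M"
    and G: "integrable M G" "\<And>x. x \<in> space M \<Longrightarrow> (Z x)\<^sup>2 \<le> G x" "expectation G \<le> K"
  shows "integrable M Z" "expectation Z \<le> sqrt K"
proof -
  have Z2: "integrable M (\<lambda>x. (Z x)\<^sup>2)"
    by (rule Bochner_Integration.integrable_bound[OF G(1)]) (use G(2) in fastforce)+
  show Z1: "integrable M Z"
    by (rule square_integrable_imp_integrable[OF _ Z2]) simp
  have "(expectation Z)\<^sup>2 \<le> expectation (\<lambda>x. (Z x)\<^sup>2)"
    using variance_positive[of Z] variance_eq[OF Z1 Z2] by simp
  also have "\<dots> \<le> expectation G"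
    by (intro integral_mono Z2 G)
  also have "\<dots> \<le> K" by (rule G(3))
  finally show "expectation Z \<le> sqrt K" by (rule real_le_rsqrt)
qed

text \<open>
  One factor \<open>m + 1\<close> under the root comes from the pointwise bound and another from the expectation
  of the dyadic energy, which is why the maximum costs \<open>m + 1\<close> compared with a single partial sum.
\<close>

theorem (in prob_space) rademacher_menshov:
  fixes S :: "nat \<Rightarrow> 'a \<Rightarrow> real"
  assumes S0: "\<And>x. S 0 x = 0" and [measurable]: "\<And>j. S j \<in> borel_measurable M"
    and int: "\<And>a l. l \<le> m \<Longrightarrow> integrable M (\<lambda>x. (S (a + 2 ^ l) x - S a x)\<^sup>2)"
    and le: "\<And>a l. l \<le> m \<Longrightarrow> expectation (\<lambda>x. (S (a + 2 ^ l) x - S a x)\<^sup>2) \<le> 2 ^ l * v"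
    and n: "1 \<le> n" "n \<le> 2 ^ m"
  shows "integrable M (\<lambda>x. MAX j\<in>{1..n}. \<bar>S j x\<bar>)"
    and "expectation (\<lambda>x. MAX j\<in>{1..n}. \<bar>S j x\<bar>) \<le> real (m + 1) * sqrt (2 ^ m * v)"
proof -
  let ?Z = "\<lambda>x. MAX j\<in>{1..n}. \<bar>S j x\<bar>"
  let ?G = "\<lambda>x. real (m + 1) * dyadic_energy (\<lambda>j. S j x) m 0"
  have Z[measurable]: "?Z \<in> borel_measurable M" by measurable
  have E: "integrable M (\<lambda>x. dyadic_energy (\<lambda>j. S j x) m 0)"
    "expectation (\<lambda>x. dyadic_energy (\<lambda>j. S j x) m 0) \<le> real (m + 1) * 2 ^ m * v"
    using dyadic_energy_expectation[of m M S v 0, OF int le] by auto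
  have G: "integrable M ?G" using E(1) by simp
  have ZG: "(?Z x)\<^sup>2 \<le> ?G x" for x
  proof -
    have "?Z x \<in> (\<lambda>j. \<bar>S j x\<bar>) ` {1..n}" using n by (intro Max_in) auto
    then obtain j where j: "j \<in> {1..n}" "?Z x = \<bar>S j x\<bar>" by auto
    have "(S (0 + j) x - S 0 x)\<^sup>2 \<le> ?G x"
      by (rule increment_le_dyadic_energy) (use j n in auto)
    then show ?thesis using j(2) S0 by simp
  qed
  have GK: "expectation ?G \<le> (real (m + 1))\<^sup>2 * (2 ^ m * v)"
  proof -
    have "expectation ?G = real (m + 1) * expectation (\<lambda>x. dyadic_energy (\<lambda>j. S j x) m 0)"
      by simp
    also have "\<dots> \<le> real (m + 1) * (real (m + 1) * 2 ^ m * v)"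
      by (intro mult_left_mono E) simp
    finally show ?thesis by (simp add: power2_eq_square mult_ac)
  qed
  show "integrable M ?Z"
    by (rule integrable_and_expectation_le_sqrt(1)[OF Z G ZG GK])
  have "expectation ?Z \<le> sqrt ((real (m + 1))\<^sup>2 * (2 ^ m * v))"
    by (rule integrable_and_expectation_le_sqrt(2)[OF Z G ZG GK])
  then show "expectation ?Z \<le> real (m + 1) * sqrt (2 ^ m * v)"
    by (simp add: real_sqrt_mult)
qed

section \<open>Second moments under decay of correlations\<close>

text \<open>
  In the double sum of covariances each row has at most \<open>2 * h + 1\<close> entries near the diagonal, which
  are bounded by \<open>v\<close>; all others are bounded by \<open>w\<close>.
\<close>

lemma second_moment_sum_le:
  fixes X :: "nat \<Rightarrow> 'a \<Rightarrow> real" and v w :: real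
  assumes int: "\<And>i j. integrable M (\<lambda>x. X i x * X j x)"
    and near: "\<And>i j. (LINT x|M. X i x * X j x) \<le> v"
    and far: "\<And>i j. i + h < j \<or> j + h < i \<Longrightarrow> (LINT x|M. X i x * X j x) \<le> w"
    and "0 \<le> v" "0 \<le> w" and "finite I"
  shows "integrable M (\<lambda>x. (\<Sum>i\<in>I. X i x)\<^sup>2)"
    and "(LINT x|M. (\<Sum>i\<in>I. X i x)\<^sup>2) \<le> real (card I) * (real (2 * h + 1) * v + real (card I) * w)"
proof -
  have eq: "(\<Sum>i\<in>I. X i x)\<^sup>2 = (\<Sum>i\<in>I. \<Sum>j\<in>I. X i x * X j x)" for x
    by (simp add: power2_eq_square sum_product)
  show "integrable M (\<lambda>x. (\<Sum>i\<in>I. X i x)\<^sup>2)"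
    unfolding eq by (intro Bochner_Integration.integrable_sum int)
  have row: "(\<Sum>j\<in>I. LINT x|M. X i x * X j x) \<le> real (2 * h + 1) * v + real (card I) * w" for i
  proof -
    have "(\<Sum>j\<in>I. LINT x|M. X i x * X j x) \<le> (\<Sum>j\<in>I. (if j \<in> {i - h..i + h} then v else 0) + w)"
    proof (rule sum_mono)
      fix j
      show "(LINT x|M. X i x * X j x) \<le> (if j \<in> {i - h..i + h} then v else 0) + w"
      proof (cases "j \<in> {i - h..i + h}")
        case True
        then show ?thesis using near[of i j] \<open>0 \<le> w\<close> by auto
      next
        case False
        then have "i + h < j \<or> j + h < i" by auto
        then show ?thesis using far[of i j] by (subst if_not_P[OF False]) simp
      qed
    qed
    also have "\<dots> = real (card (I \<inter> {i - h..i + h})) * v + real (card I) * w"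
      using \<open>finite I\<close> by (simp add: sum.distrib sum.If_cases Int_def conj_commute)
    also have "\<dots> \<le> real (2 * h + 1) * v + real (card I) * w"
    proof -
      have "card (I \<inter> {i - h..i + h}) \<le> card {i - h..i + h}" by (intro card_mono) auto
      also have "\<dots> \<le> 2 * h + 1" by simp
      finally show ?thesis using \<open>0 \<le> v\<close> by (intro add_right_mono mult_right_mono) auto
    qed
    finally show ?thesis .
  qed
  have "(LINT x|M. (\<Sum>i\<in>I. X i x)\<^sup>2) = (\<Sum>i\<in>I. \<Sum>j\<in>I. LINT x|M. X i x * X j x)"
    unfolding eq by (simp add: int)
  also have "\<dots> \<le> (\<Sum>i\<in>I. real (2 * h + 1) * v + real (card I) * w)"
    by (intro sum_mono row)
  finally show "(LINT x|M. (\<Sum>i\<in>I. X i x)\<^sup>2) \<le> real (card I) * (real (2 * h + 1) * v + real (card I) * w)"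
    by simp
qed

lemma measure_preserving_funpow:
  assumes "measure_preserving_map M F"
  shows "measure_preserving_map M (F ^^ k)"
proof (induction k)
  case 0
  then show ?case by (simp add: measure_preserving_map_def distr_id)
next
  case (Suc k)
  have "distr M M (F \<circ> F ^^ k) = distr (distr M M (F ^^ k)) M F"
    using Suc assms by (subst distr_distr) (auto simp: measure_preserving_map_def)
  then show ?case
    using Suc assms unfolding measure_preserving_map_def funpow.simps
    by (auto intro: measurable_comp)
qed

lemma measure_preserving_integral:
  fixes f :: "'a \<Rightarrow> real"
  assumes T: "measure_preserving_map M T" and f: "f \<in> borel_measurable M"
  shows "(LINT x|M. f (T x)) = (LINT x|M. f x)"
    and "integrable M (\<lambda>x. f (T x)) \<longleftrightarrow> integrable M f"
  using integral_distr[of T M M f] integrable_distr_eq[of T M M f] assms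
  by (auto simp: measure_preserving_map_def)

lemma measure_preserving_covariance:
  fixes f :: "'a \<Rightarrow> real"
  assumes F: "measure_preserving_map M F" and [measurable]: "f \<in> borel_measurable M"
    and "i \<le> j"
  shows "(LINT x|M. f ((F ^^ i) x) * f ((F ^^ j) x)) = (LINT x|M. f x * f ((F ^^ (j - i)) x))"
    and "integrable M (\<lambda>x. f ((F ^^ i) x) * f ((F ^^ j) x)) \<longleftrightarrow>
      integrable M (\<lambda>x. f x * f ((F ^^ (j - i)) x))"
proof -
  have [measurable]: "F ^^ k \<in> measurable M M" for k
    using measure_preserving_funpow[OF F] by (simp add: measure_preserving_map_def)
  have j: "(F ^^ j) x = (F ^^ (j - i)) ((F ^^ i) x)" for x
    using \<open>i \<le> j\<close> by (metis comp_apply funpow_add le_add_diff_inverse2)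
  have m: "(\<lambda>x. f x * f ((F ^^ (j - i)) x)) \<in> borel_measurable M" by measurable
  note * = measure_preserving_integral[OF measure_preserving_funpow[OF F, of i] m]
  show "(LINT x|M. f ((F ^^ i) x) * f ((F ^^ j) x)) = (LINT x|M. f x * f ((F ^^ (j - i)) x))"
    using *(1) unfolding j .
  show "integrable M (\<lambda>x. f ((F ^^ i) x) * f ((F ^^ j) x)) \<longleftrightarrow>
      integrable M (\<lambda>x. f x * f ((F ^^ (j - i)) x))"
    using *(2) unfolding j .
qed

text \<open>
  The cutoff \<open>h\<close> is free: covariances at lags up to \<open>h\<close> are bounded by the second moment of \<open>f\<close>, and
  only those at larger lags by the correlation estimate. This matters because the constant \<open>R\<close>
  will contain the norms of \<open>f\<close>, which may be far larger than its second moment.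
\<close>

lemma (in prob_space) maximal_inequality_exponential_decay:
  fixes f :: "'a \<Rightarrow> real"
  assumes F: "measure_preserving_map M F" and f[measurable]: "f \<in> borel_measurable M"
    and int: "\<And>k. integrable M (\<lambda>x. f x * f ((F ^^ k) x))"
    and decay: "\<And>k. \<bar>expectation (\<lambda>x. f x * f ((F ^^ k) x))\<bar> \<le> R * \<theta> ^ k"
    and \<theta>: "0 < \<theta>" "\<theta> < 1" and n: "1 \<le> n" "n \<le> 2 ^ m"
  defines "S \<equiv> \<lambda>j x. \<Sum>i=1..j. f ((F ^^ i) x)"
  shows "integrable M (\<lambda>x. MAX j\<in>{1..n}. \<bar>S j x\<bar>)"
    and "expectation (\<lambda>x. MAX j\<in>{1..n}. \<bar>S j x\<bar>) \<le>
      real (m + 1) *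
      sqrt (2 ^ m * (real (2 * h + 1) * expectation (\<lambda>x. (f x)\<^sup>2) + 2 ^ m * (R * \<theta> ^ h)))"
proof -
  let ?v = "expectation (\<lambda>x. (f x)\<^sup>2)"
  have [measurable]: "F ^^ k \<in> measurable M M" for k
    using measure_preserving_funpow[OF F] by (simp add: measure_preserving_map_def)
  define X where "X = (\<lambda>i x. f ((F ^^ i) x))"
  have [measurable]: "X i \<in> borel_measurable M" for i unfolding X_def by measurable
  have R: "0 \<le> R" using order_trans[OF abs_ge_zero decay[of 0]] by simp
  have Xint: "integrable M (\<lambda>x. X i x * X j x)" for i j
  proof (induction i j rule: linorder_wlog)
    case (le i j)
    show ?case unfolding X_def
      using measure_preserving_covariance(2)[OF F f le] int by simp
  next
    case (sym i j)
    then show ?case by (simp add: mult.commute)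
  qed
  have X2: "integrable M (\<lambda>x. (X i x)\<^sup>2)" "expectation (\<lambda>x. (X i x)\<^sup>2) = ?v" for i
    using Xint[of i i] measure_preserving_covariance(1)[OF F f, of i i]
    by (simp_all add: power2_eq_square X_def)
  have near: "expectation (\<lambda>x. X i x * X j x) \<le> ?v" for i j
  proof -
    have "expectation (\<lambda>x. X i x * X j x) \<le> expectation (\<lambda>x. ((X i x)\<^sup>2 + (X j x)\<^sup>2) / 2)"
    proof (intro integral_mono Xint)
      show "integrable M (\<lambda>x. ((X i x)\<^sup>2 + (X j x)\<^sup>2) / 2)" using X2(1) by simp
      show "X i x * X j x \<le> ((X i x)\<^sup>2 + (X j x)\<^sup>2) / 2" for x
        using sum_squares_bound[of "X i x" "X j x"] by simp
    qed
    also have "\<dots> = ?v" using X2 by simp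
    finally show ?thesis .
  qed
  have far_ordered: "expectation (\<lambda>x. X i x * X j x) \<le> R * \<theta> ^ h" if "i + h < j" for i j
  proof -
    have "expectation (\<lambda>x. X i x * X j x) = expectation (\<lambda>x. f x * f ((F ^^ (j - i)) x))"
      unfolding X_def using measure_preserving_covariance(1)[OF F f, of i j] that by simp
    also have "\<dots> \<le> R * \<theta> ^ (j - i)" using decay[of "j - i"] by simp
    also have "\<dots> \<le> R * \<theta> ^ h"
      using that R \<theta> by (intro mult_left_mono power_decreasing) auto
    finally show ?thesis .
  qed
  have far: "expectation (\<lambda>x. X i x * X j x) \<le> R * \<theta> ^ h" if "i + h < j \<or> j + h < i" for i j
    using far_ordered[of i j] far_ordered[of j i] that by (auto simp: mult.commute)
  have v: "0 \<le> ?v" by simp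
  have w: "0 \<le> R * \<theta> ^ h" using R \<theta> by simp
  note moment = second_moment_sum_le[OF Xint near far v w]
  have incr: "S (a + N) x - S a x = (\<Sum>i\<in>{a<..a + N}. X i x)" for a N x
  proof -
    have "{1..a + N} = {1..a} \<union> {a<..a + N}" by auto
    then have "S (a + N) x = S a x + (\<Sum>i\<in>{a<..a + N}. X i x)"
      unfolding S_def X_def by (subst sum.union_disjoint[symmetric]) auto
    then show ?thesis by simp
  qed
  let ?V = "real (2 * h + 1) * ?v + 2 ^ m * (R * \<theta> ^ h)"
  have i: "integrable M (\<lambda>x. (S (a + 2 ^ l) x - S a x)\<^sup>2)" for a l
    unfolding incr by (rule moment(1)) auto
  have le: "expectation (\<lambda>x. (S (a + 2 ^ l) x - S a x)\<^sup>2) \<le> 2 ^ l * ?V" if "l \<le> m" for a l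
  proof -
    have "expectation (\<lambda>x. (S (a + 2 ^ l) x - S a x)\<^sup>2) \<le>
        2 ^ l * (real (2 * h + 1) * ?v + 2 ^ l * (R * \<theta> ^ h))"
      unfolding incr using moment(2)[where I = "{a<..a + 2 ^ l}"] by simp
    also have "\<dots> \<le> 2 ^ l * ?V"
      using that w by (intro mult_left_mono add_mono mult_right_mono power_increasing) auto
    finally show ?thesis .
  qed
  have S0: "S 0 x = 0" for x by (simp add: S_def)
  have Sm: "S j \<in> borel_measurable M" for j unfolding S_def by measurable
  show "integrable M (\<lambda>x. MAX j\<in>{1..n}. \<bar>S j x\<bar>)"
    by (rule rademacher_menshov(1)[OF S0 Sm i le n])
  show "expectation (\<lambda>x. MAX j\<in>{1..n}. \<bar>S j x\<bar>) \<le> real (m + 1) * sqrt (2 ^ m * ?V)"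
    by (rule rademacher_menshov(2)[OF S0 Sm i le n])
qed

section \<open>Moments of observables with a stable index\<close>

text \<open>
  As \<open>L (2 * x) / L x\<close> tends to 1, doubling \<open>x\<close> eventually multiplies the tail by at most
  \<open>2 powr (-t)\<close> for any \<open>t < \<alpha>\<close>. Iterating this from a single starting point \<open>x0\<close> gives geometric
  decay along \<open>2 ^ k * x0\<close>.
\<close>

lemma stable_index_tail_doubling:
  assumes "prob_space M" and "has_stable_index M \<phi> \<alpha>" and "t < \<alpha>"
  obtains x0 where "x0 > 0"
    "\<And>k. measure M {y \<in> space M. \<bar>\<phi> y\<bar> > 2 ^ k * x0} \<le> (2 powr (-t)) ^ k"
proof -
  interpret prob_space M by fact
  define T where "T = (\<lambda>x. measure M {y \<in> space M. \<bar>\<phi> y\<bar> > x})"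
  obtain L where L: "slowly_varying L" "\<And>x. x > 0 \<Longrightarrow> T x = x powr (-\<alpha>) * L x"
    using assms(2) unfolding has_stable_index_def T_def by blast
  have pos: "\<forall>\<^sub>F x in at_top. L x > 0" and lim: "((\<lambda>x. L (2 * x) / L x) \<longlongrightarrow> 1) at_top"
    using L(1) by (auto simp: slowly_varying_def)
  have "2 powr (\<alpha> - t) > 1" using assms(3) by simp
  then have "\<forall>\<^sub>F x in at_top. L (2 * x) / L x < 2 powr (\<alpha> - t)"
    by (rule order_tendstoD(2)[OF lim])
  with pos have "\<forall>\<^sub>F x in at_top. x > 0 \<and> T (2 * x) \<le> 2 powr (-t) * T x"
    using eventually_gt_at_top[of 0]
  proof eventually_elim
    case (elim x)
    have "T (2 * x) = 2 powr (-\<alpha>) * x powr (-\<alpha>) * L (2 * x)"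
      using elim L(2)[of "2 * x"] by (simp add: powr_mult)
    also have "\<dots> \<le> 2 powr (-\<alpha>) * x powr (-\<alpha>) * (2 powr (\<alpha> - t) * L x)"
      using elim by (intro mult_left_mono) (auto simp: field_simps)
    also have "\<dots> = 2 powr (-t) * T x"
      using elim L(2)[of x] by (simp add: powr_diff powr_minus field_simps)
    finally show ?case using elim by simp
  qed
  then obtain x0 where x0: "x0 > 0" "\<And>x. x \<ge> x0 \<Longrightarrow> T (2 * x) \<le> 2 powr (-t) * T x"
    unfolding eventually_at_top_linorder by (metis order.refl)
  have "T (2 ^ k * x0) \<le> (2 powr (-t)) ^ k" for k
  proof (induction k)
    case 0
    then show ?case by (simp add: T_def)
  next
    case (Suc k)
    have "1 * x0 \<le> 2 ^ k * x0" using x0(1) by (intro mult_right_mono) auto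
    then have "T (2 * (2 ^ k * x0)) \<le> 2 powr (-t) * T (2 ^ k * x0)" by (intro x0(2)) simp
    also have "\<dots> \<le> 2 powr (-t) * (2 powr (-t)) ^ k" by (intro mult_left_mono Suc) simp
    finally show ?case by (simp add: mult.assoc)
  qed
  with x0(1) show ?thesis by (intro that[of x0]) (simp_all add: T_def)
qed

text \<open>
  Cutting the values of \<open>\<bar>\<phi>\<bar>\<close> at the levels \<open>2 ^ k * x0\<close> bounds the moment by a geometric
  series of ratio \<open>2 powr (s - t)\<close>, for some \<open>t\<close> between \<open>s\<close> and \<open>\<alpha>\<close>.
\<close>

lemma stable_index_moment:
  assumes "prob_space M" and stable: "has_stable_index M \<phi> \<alpha>" and s: "0 < s" "s < \<alpha>"
  shows "integrable M (\<lambda>x. \<bar>\<phi> x\<bar> powr s)"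
proof -
  interpret prob_space M by fact
  have [measurable]: "\<phi> \<in> borel_measurable M" using stable by (simp add: has_stable_index_def)
  obtain t where t: "s < t" "t < \<alpha>" using dense[OF s(2)] by auto
  obtain x0 where x0: "x0 > 0"
    and tail: "\<And>k. measure M {y \<in> space M. \<bar>\<phi> y\<bar> > 2 ^ k * x0} \<le> (2 powr (-t)) ^ k"
    using stable_index_tail_doubling[OF assms(1,2) t(2)] by blast
  define A where "A k = {y \<in> space M. \<bar>\<phi> y\<bar> > 2 ^ k * x0}" for k :: nat
  define c where "c k = (2 ^ Suc k * x0) powr s" for k :: nat
  have [measurable]: "A k \<in> sets M" for k unfolding A_def by measurable
  have term_le: "u k \<le> suminf u" for u :: "nat \<Rightarrow> ennreal" and k
    using sum_le_suminf[of u "{k}"] by simp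
  have pointwise: "ennreal (\<bar>\<phi> x\<bar> powr s) \<le> ennreal (x0 powr s) + (\<Sum>k. ennreal (c k) * indicator (A k) x)"
    if x: "x \<in> space M" for x
  proof (cases "\<bar>\<phi> x\<bar> \<le> x0")
    case True
    then have "\<bar>\<phi> x\<bar> powr s \<le> x0 powr s" using s by (intro powr_mono2) auto
    then show ?thesis by (intro add_increasing2) (auto intro: ennreal_leI)
  next
    case False
    obtain N where "\<bar>\<phi> x\<bar> / x0 < 2 ^ N" using real_arch_pow[of 2] by auto
    then have ex: "\<bar>\<phi> x\<bar> \<le> 2 ^ N * x0" using x0 by (simp add: field_simps)
    define K where "K = (LEAST k. \<bar>\<phi> x\<bar> \<le> 2 ^ k * x0)"
    have K: "\<bar>\<phi> x\<bar> \<le> 2 ^ K * x0" unfolding K_def by (rule LeastI[of _ N]) (rule ex)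
    with False obtain k where k: "K = Suc k" by (cases K) auto
    \<comment> \<open>By minimality of \<open>K\<close>, the value \<open>\<bar>\<phi> x\<bar>\<close> lies between the levels \<open>k\<close> and \<open>k + 1\<close>.\<close>
    have "\<not> \<bar>\<phi> x\<bar> \<le> 2 ^ k * x0"
      by (rule not_less_Least) (use k in \<open>simp add: K_def[symmetric]\<close>)
    then have xk: "x \<in> A k" using x by (auto simp: A_def)
    have "\<bar>\<phi> x\<bar> powr s \<le> c k" unfolding c_def using K k s by (intro powr_mono2) auto
    then have "ennreal (\<bar>\<phi> x\<bar> powr s) \<le> ennreal (c k) * indicator (A k) x"
      using xk by (auto intro: ennreal_leI)
    also have "\<dots> \<le> (\<Sum>k. ennreal (c k) * indicator (A k) x)"
      by (rule term_le)
    finally show ?thesis by (rule add_increasing[OF zero_le])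
  qed
  have "(\<integral>\<^sup>+x. ennreal (\<bar>\<phi> x\<bar> powr s) \<partial>M) \<le>
      (\<integral>\<^sup>+x. ennreal (x0 powr s) + (\<Sum>k. ennreal (c k) * indicator (A k) x) \<partial>M)"
    by (intro nn_integral_mono pointwise)
  also have "\<dots> = ennreal (x0 powr s) + (\<Sum>k. ennreal (c k) * emeasure M (A k))"
    by (simp add: nn_integral_add nn_integral_suminf nn_integral_cmult_indicator emeasure_space_1)
  also have "(\<Sum>k. ennreal (c k) * emeasure M (A k)) \<le> (\<Sum>k. ennreal ((2 * x0) powr s * (2 powr (s - t)) ^ k))"
  proof (intro suminf_le summableI)
    fix k
    have c_eq: "c k = (2 * x0) powr s * (2 powr s) ^ k"
      using x0 by (simp add: c_def powr_mult powr_power mult_ac powr_powr flip: powr_realpow)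
    have "c k * measure M (A k) \<le> c k * (2 powr (-t)) ^ k"
      unfolding A_def by (intro mult_left_mono tail) (simp add: c_def)
    also have "\<dots> = (2 * x0) powr s * (2 powr (s - t)) ^ k"
      unfolding c_eq by (simp add: powr_diff powr_minus field_simps power_divide)
    finally show "ennreal (c k) * emeasure M (A k) \<le> ennreal ((2 * x0) powr s * (2 powr (s - t)) ^ k)"
      unfolding emeasure_eq_measure
      by (subst ennreal_mult'[symmetric]) (simp_all add: c_def ennreal_leI)
  qed
  also have "(\<Sum>k. ennreal ((2 * x0) powr s * (2 powr (s - t)) ^ k)) < \<infinity>"
  proof -
    have "2 powr (s - t) < 2 powr (0::real)" using t by (intro powr_less_mono) auto
    then have "summable (\<lambda>k. (2 * x0) powr s * (2 powr (s - t)) ^ k)"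
      by (intro summable_mult summable_geometric) simp
    then show ?thesis
      by (subst suminf_ennreal2) auto
  qed
  finally have "(\<integral>\<^sup>+x. ennreal (\<bar>\<phi> x\<bar> powr s) \<partial>M) < \<infinity>"
    by (simp add: ennreal_add_left_cancel_less less_top)
  then show ?thesis by (intro integrableI_nonneg) auto
qed

section \<open>Convergence in distribution to a constant\<close>

text \<open>
  Convergence in distribution is tested only at continuity points of the limit, so the
  atom \<open>a\<close> itself, where the distribution functions may fail to converge, is excluded.
\<close>

lemma not_isCont_cdf_return: "\<not> isCont (cdf (return borel a)) a"
proof
  assume cont: "isCont (cdf (return borel a)) a"
  have "(\<lambda>n. a - 1 / real (Suc n)) \<longlonglongrightarrow> a - 0"
    by (intro tendsto_intros LIMSEQ_Suc lim_1_over_n)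
  then have "(\<lambda>n. a - 1 / real (Suc n)) \<longlonglongrightarrow> a" by simp
  from isCont_tendsto_compose[OF cont this]
  have "(\<lambda>n. cdf (return borel a) (a - 1 / real (Suc n))) \<longlonglongrightarrow> 1"
    by (simp add: cdf_def measure_return)
  moreover have "cdf (return borel a) (a - 1 / real (Suc n)) = 0" for n
    by (simp add: cdf_def measure_return)
  ultimately have "(\<lambda>n::nat. 0::real) \<longlonglongrightarrow> 1" by simp
  then show False by (simp add: LIMSEQ_const_iff)
qed

text \<open>
  By Markov's inequality the mass outside any neighbourhood of \<open>a\<close> vanishes in the limit, and a
  distribution function at \<open>x \<noteq> a\<close> deviates from that of the point mass at \<open>a\<close> by at most the mass
  at distance \<open>\<bar>x - a\<bar>\<close> or more.
\<close>

lemma (in prob_space) converges_in_distribution_to_const_if_L1: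
  fixes Y :: "nat \<Rightarrow> 'a \<Rightarrow> real"
  assumes meas: "\<And>n. Y n \<in> borel_measurable M"
    and int: "\<And>n. integrable M (\<lambda>x. \<bar>Y n x - a\<bar>)"
    and lim: "(\<lambda>n. expectation (\<lambda>x. \<bar>Y n x - a\<bar>)) \<longlonglongrightarrow> 0"
  shows "converges_in_distribution_to_const M Y a"
  unfolding converges_in_distribution_to_const_def weak_conv_m_def weak_conv_def
proof (intro allI impI)
  fix x assume "isCont (cdf (return borel a)) x"
  then have "x \<noteq> a" using not_isCont_cdf_return by blast
  define d where "d = \<bar>x - a\<bar>"
  have d: "d > 0" using \<open>x \<noteq> a\<close> by (simp add: d_def)
  note [measurable] = meas
  have cdf_Y: "cdf (distr M borel (Y n)) x = prob {y \<in> space M. Y n y \<le> x}" for n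
    by (simp add: cdf_def measure_distr) (rule arg_cong[where f = prob], auto)
  have lim0: "(\<lambda>n. prob {y \<in> space M. \<bar>Y n y - a\<bar> \<ge> d}) \<longlonglongrightarrow> 0"
  proof (rule tendsto_sandwich[OF _ _ tendsto_const])
    show "\<forall>\<^sub>F n in sequentially. prob {y \<in> space M. \<bar>Y n y - a\<bar> \<ge> d} \<le> expectation (\<lambda>x. \<bar>Y n x - a\<bar>) / d"
      using int d by (intro always_eventually allI integral_Markov_inequality_measure[where A = "{}"]) auto
    show "(\<lambda>n. expectation (\<lambda>x. \<bar>Y n x - a\<bar>) / d) \<longlonglongrightarrow> 0"
      using tendsto_divide[OF lim tendsto_const, of d] d by simp
  qed auto
  have dev: "\<bar>prob {y \<in> space M. Y n y \<le> x} - indicator {..x} a\<bar> \<le> prob {y \<in> space M. \<bar>Y n y - a\<bar> \<ge> d}" for n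
  proof (cases "x < a")
    case True
    have "prob {y \<in> space M. Y n y \<le> x} \<le> prob {y \<in> space M. \<bar>Y n y - a\<bar> \<ge> d}"
      using True by (intro finite_measure_mono) (auto simp: d_def)
    then show ?thesis using True by simp
  next
    case False
    have "1 - prob {y \<in> space M. Y n y \<le> x} = prob {y \<in> space M. \<not> Y n y \<le> x}"
      by (subst prob_neg) auto
    also have "\<dots> \<le> prob {y \<in> space M. \<bar>Y n y - a\<bar> \<ge> d}"
      using False by (intro finite_measure_mono) (auto simp: d_def)
    finally show ?thesis using False by simp
  qed
  have "(\<lambda>n. prob {y \<in> space M. Y n y \<le> x} - indicator {..x} a) \<longlonglongrightarrow> 0"
    by (rule Lim_null_comparison[OF _ lim0]) (use dev in simp)
  then show "(\<lambda>n. cdf (distr M borel (Y n)) x) \<longlonglongrightarrow> cdf (return borel a) x"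
    unfolding cdf_Y by (simp add: cdf_def measure_return LIM_zero_iff)
qed

section \<open>The maximal inequality for a truncated observable\<close>

lemma abs_excess_le_moment:
  fixes y b s :: real
  assumes "0 < b" "1 \<le> s"
  shows "\<bar>y - y * indicator {z. \<bar>z\<bar> < b} y\<bar> \<le> b powr (1 - s) * \<bar>y\<bar> powr s"
proof (cases "\<bar>y\<bar> < b")
  case False
  have "\<bar>y\<bar> = \<bar>y\<bar> powr (1 - s) * \<bar>y\<bar> powr s"
    using False assms by (simp flip: powr_add)
  also have "\<dots> \<le> b powr (1 - s) * \<bar>y\<bar> powr s"
    using False assms by (intro mult_right_mono powr_mono2') auto
  finally show ?thesis using False by simp
qed simp

lemma square_truncation_le_moment:
  fixes y b s :: real
  assumes "0 < b" "0 < s" "s \<le> 2"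
  shows "(y * indicator {z. \<bar>z\<bar> < b} y)\<^sup>2 \<le> b powr (2 - s) * \<bar>y\<bar> powr s"
proof (cases "\<bar>y\<bar> < b \<and> y \<noteq> 0")
  case True
  have "y\<^sup>2 = \<bar>y\<bar> powr 2" using True by simp
  also have "\<dots> = \<bar>y\<bar> powr (2 - s) * \<bar>y\<bar> powr s"
    by (simp flip: powr_add)
  also have "\<dots> \<le> b powr (2 - s) * \<bar>y\<bar> powr s"
    using True assms by (intro mult_right_mono powr_mono2) auto
  finally show ?thesis using True by simp
qed auto

lemma abs_Max_partial_sums_le:
  fixes x u r :: "nat \<Rightarrow> real"
  assumes "1 \<le> n" and x: "\<And>i. x i = u i + r i"
  shows "\<bar>MAX j\<in>{1..n}. \<Sum>i=1..j. x i\<bar> \<le> (MAX j\<in>{1..n}. \<bar>\<Sum>i=1..j. u i\<bar>) + (\<Sum>i=1..n. \<bar>r i\<bar>)"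
proof -
  have "(MAX j\<in>{1..n}. \<Sum>i=1..j. x i) \<in> (\<lambda>j. \<Sum>i=1..j. x i) ` {1..n}"
    using \<open>1 \<le> n\<close> by (intro Max_in) auto
  then obtain j where j: "j \<in> {1..n}" "(MAX j\<in>{1..n}. \<Sum>i=1..j. x i) = (\<Sum>i=1..j. x i)" by auto
  have "(\<Sum>i=1..j. x i) = (\<Sum>i=1..j. u i) + (\<Sum>i=1..j. r i)" by (simp add: x sum.distrib)
  moreover have "\<bar>\<Sum>i=1..j. u i\<bar> \<le> (MAX j\<in>{1..n}. \<bar>\<Sum>i=1..j. u i\<bar>)"
    using j by (intro Max_ge) auto
  moreover have "\<bar>\<Sum>i=1..j. r i\<bar> \<le> (\<Sum>i=1..n. \<bar>r i\<bar>)"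
    using j by (intro order_trans[OF sum_abs] sum_mono2) auto
  ultimately show ?thesis unfolding j(2) by linarith
qed

lemma (in finite_measure) integrable_square_if_bounded:
  fixes u :: "'a \<Rightarrow> real"
  assumes [measurable]: "u \<in> borel_measurable M" and "\<And>x. \<bar>u x\<bar> \<le> B"
  shows "integrable M (\<lambda>x. (u x)\<^sup>2)"
proof (rule integrable_const_bound[where B = "B\<^sup>2"])
  have "(u x)\<^sup>2 \<le> B\<^sup>2" for x
    using power_mono[OF assms(2) abs_ge_zero, of x 2] by simp
  then show "AE x in M. norm ((u x)\<^sup>2) \<le> B\<^sup>2" by simp
qed measurable

lemma (in prob_space) abs_centred_le:
  fixes u :: "'a \<Rightarrow> real"
  assumes "u \<in> borel_measurable M" and le: "\<And>x. \<bar>u x\<bar> \<le> B"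
  shows "\<bar>u x - expectation u\<bar> \<le> 2 * B"
proof -
  have "integrable M u"
    by (rule integrable_const_bound[where B = B]) (use assms in auto)
  then have "expectation (\<lambda>x. \<bar>u x\<bar>) \<le> expectation (\<lambda>x. B)"
    using le by (intro integral_mono) auto
  then have "expectation (\<lambda>x. \<bar>u x\<bar>) \<le> B"
    by (simp add: prob_space)
  then have "\<bar>expectation u\<bar> \<le> B"
    by (rule order_trans[OF integral_abs_bound])
  then show ?thesis using le[of x] by linarith
qed

text \<open>
  The first summand of the bound comes from \<open>f\<close>, the second from the remainder
  \<open>\<phi> - expectation \<phi> - f\<close>. The second moment of \<open>f\<close> is compared with the variance of the truncation
  \<open>\<psi>\<close>, because the interpolation between the sup norm and the \<open>L\<^sup>1\<close> norm is affordable only for the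
  error: that one has \<open>L\<^sup>1\<close> norm at most \<open>\<eta>\<close>, whereas the \<open>L\<^sup>1\<close> norm of \<open>f\<close> need not be small, and
  \<open>n * b\<close> need not be small compared with \<open>b\<^sup>2\<close>.
\<close>

lemma (in prob_space) truncated_maximal_inequality:
  fixes \<phi> f :: "'a \<Rightarrow> real" and b s :: real
  assumes F: "measure_preserving_map M F"
    and [measurable]: "\<phi> \<in> borel_measurable M"
    and moment: "integrable M (\<lambda>x. \<bar>\<phi> x\<bar> powr s)" and s: "1 \<le> s" "s \<le> 2" and b: "0 < b"
  defines "\<psi> \<equiv> \<lambda>x. \<phi> x * indicator {y. \<bar>y\<bar> < b} (\<phi> x)"
  assumes f_int: "integrable M f"
    and f_bound: "AE x in M. \<bar>f x\<bar> \<le> C * (2 * b)" and C: "0 \<le> C"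
    and approx: "expectation (\<lambda>x. \<bar>\<psi> x - expectation \<psi> - f x\<bar>) \<le> \<eta>"
    and corr_int: "\<And>k. integrable M (\<lambda>x. f x * f ((F ^^ k) x))"
    and decay: "\<And>k. \<bar>expectation (\<lambda>x. f x * f ((F ^^ k) x))\<bar> \<le> R * \<theta> ^ k"
    and \<theta>: "0 < \<theta>" "\<theta> < 1" and n: "1 \<le> n" "n \<le> 2 ^ m"
  shows "integrable M (\<lambda>x. MAX j\<in>{1..n}. \<Sum>i=1..j. (\<phi> ((F ^^ i) x) - expectation \<phi>))"
    and "expectation (\<lambda>x. \<bar>MAX j\<in>{1..n}. \<Sum>i=1..j. (\<phi> ((F ^^ i) x) - expectation \<phi>)\<bar>) \<le>
      real (m + 1) * sqrt (2 ^ m * (real (2 * h + 1) *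
        (2 * (b powr (2 - s) * expectation (\<lambda>x. \<bar>\<phi> x\<bar> powr s)) + 4 * (1 + C) * b * \<eta>)
        + 2 ^ m * (R * \<theta> ^ h))) +
      real n * (2 * (b powr (1 - s) * expectation (\<lambda>x. \<bar>\<phi> x\<bar> powr s)) + \<eta>)"
proof -
  let ?M = "expectation (\<lambda>x. \<bar>\<phi> x\<bar> powr s)"
  let ?Z = "\<lambda>x. MAX j\<in>{1..n}. \<bar>\<Sum>i=1..j. f ((F ^^ i) x)\<bar>"
  let ?Y = "\<lambda>x. MAX j\<in>{1..n}. \<Sum>i=1..j. (\<phi> ((F ^^ i) x) - expectation \<phi>)"
  note Fk = measure_preserving_funpow[OF F]
  have [measurable]: "F ^^ k \<in> measurable M M" for k
    using Fk by (simp add: measure_preserving_map_def)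
  have f[measurable]: "f \<in> borel_measurable M" using f_int by simp
  have \<psi>_meas[measurable]: "\<psi> \<in> borel_measurable M" unfolding \<psi>_def by measurable
  have \<psi>_le: "\<bar>\<psi> x\<bar> \<le> b" for x using b by (auto simp: \<psi>_def indicator_def)
  have \<psi>_int: "integrable M \<psi>"
    by (rule integrable_const_bound[where B = b]) (use \<psi>_le in auto)
  have excess: "\<bar>\<phi> x - \<psi> x\<bar> \<le> b powr (1 - s) * \<bar>\<phi> x\<bar> powr s" for x
    unfolding \<psi>_def by (rule abs_excess_le_moment) (use b s in auto)
  have excess_int: "integrable M (\<lambda>x. \<phi> x - \<psi> x)"
    by (rule Bochner_Integration.integrable_bound[of _ "\<lambda>x. b powr (1 - s) * \<bar>\<phi> x\<bar> powr s"])
      (use moment excess in auto)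
  have excess_le: "expectation (\<lambda>x. \<bar>\<phi> x - \<psi> x\<bar>) \<le> b powr (1 - s) * ?M"
  proof -
    have "expectation (\<lambda>x. \<bar>\<phi> x - \<psi> x\<bar>) \<le> expectation (\<lambda>x. b powr (1 - s) * \<bar>\<phi> x\<bar> powr s)"
      by (intro integral_mono excess) (use moment excess_int in auto)
    then show ?thesis by simp
  qed
  have \<phi>_int: "integrable M \<phi>"
    using Bochner_Integration.integrable_add[OF excess_int \<psi>_int] by simp

  define e where "e = (\<lambda>x. \<psi> x - expectation \<psi> - f x)"
  have e_int: "integrable M e" unfolding e_def using \<psi>_int f_int by simp
  have centred_le: "\<bar>\<psi> x - expectation \<psi>\<bar> \<le> 2 * b" for x
    by (rule abs_centred_le[OF \<psi>_meas \<psi>_le])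

  define r where "r = (\<lambda>x. \<phi> x - expectation \<phi> - f x)"
  have r_int: "integrable M r" unfolding r_def using \<phi>_int f_int by simp
  have r_le: "expectation (\<lambda>x. \<bar>r x\<bar>) \<le> 2 * (b powr (1 - s) * ?M) + \<eta>"
  proof -
    define \<delta> where "\<delta> = expectation (\<lambda>x. \<bar>\<phi> x - \<psi> x\<bar>)"
    have mean: "\<bar>expectation \<phi> - expectation \<psi>\<bar> \<le> \<delta>"
      using integral_abs_bound[of M "\<lambda>x. \<phi> x - \<psi> x"] \<phi>_int \<psi>_int by (simp add: \<delta>_def)
    have "expectation (\<lambda>x. \<bar>r x\<bar>) \<le> expectation (\<lambda>x. \<bar>\<phi> x - \<psi> x\<bar> + \<delta> + \<bar>e x\<bar>)"
    proof (intro integral_mono)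
      show "\<bar>r x\<bar> \<le> \<bar>\<phi> x - \<psi> x\<bar> + \<delta> + \<bar>e x\<bar>" for x
        using mean unfolding r_def e_def by linarith
    qed (use r_int excess_int e_int in auto)
    also have "\<dots> = \<delta> + \<delta> + expectation (\<lambda>x. \<bar>e x\<bar>)"
      using excess_int e_int by (simp add: \<delta>_def prob_space)
    also have "\<dots> \<le> 2 * (b powr (1 - s) * ?M) + \<eta>"
      using excess_le approx unfolding \<delta>_def e_def by linarith
    finally show ?thesis .
  qed

  have f2_int: "integrable M (\<lambda>x. (f x)\<^sup>2)" using corr_int[of 0] by (simp add: power2_eq_square)
  have \<psi>2_int: "integrable M (\<lambda>x. (\<psi> x)\<^sup>2)"
    by (rule integrable_square_if_bounded[where B = b]) (use \<psi>_le in auto)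
  have centred_int: "integrable M (\<lambda>x. (\<psi> x - expectation \<psi>)\<^sup>2)"
    by (rule integrable_square_if_bounded[where B = "2 * b"]) (use centred_le in auto)
  have variance: "expectation (\<lambda>x. (\<psi> x - expectation \<psi>)\<^sup>2) \<le> b powr (2 - s) * ?M"
  proof -
    have "expectation (\<lambda>x. (\<psi> x - expectation \<psi>)\<^sup>2) \<le> expectation (\<lambda>x. (\<psi> x)\<^sup>2)"
      using variance_eq[OF \<psi>_int \<psi>2_int] by simp
    also have "\<dots> \<le> expectation (\<lambda>x. b powr (2 - s) * \<bar>\<phi> x\<bar> powr s)"
    proof (intro integral_mono)
      show "(\<psi> x)\<^sup>2 \<le> b powr (2 - s) * \<bar>\<phi> x\<bar> powr s" for x
        unfolding \<psi>_def by (rule square_truncation_le_moment) (use b s in auto)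
    qed (use \<psi>2_int moment in auto)
    finally show ?thesis by simp
  qed
  have f2_le: "expectation (\<lambda>x. (f x)\<^sup>2) \<le> 2 * (b powr (2 - s) * ?M) + 4 * (1 + C) * b * \<eta>"
  proof -
    have "expectation (\<lambda>x. (f x)\<^sup>2) \<le>
        expectation (\<lambda>x. 2 * (\<psi> x - expectation \<psi>)\<^sup>2 + 4 * (1 + C) * b * \<bar>e x\<bar>)"
    proof (rule integral_mono_AE)
      show "AE x in M. (f x)\<^sup>2 \<le> 2 * (\<psi> x - expectation \<psi>)\<^sup>2 + 4 * (1 + C) * b * \<bar>e x\<bar>"
        using f_bound
      proof eventually_elim
        case (elim x)
        have f_eq: "f x = (\<psi> x - expectation \<psi>) - e x" by (simp add: e_def)
        have "\<bar>e x\<bar> \<le> 2 * (1 + C) * b"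
          using elim centred_le[of x] by (auto simp: e_def algebra_simps abs_le_iff)
        then have "(e x)\<^sup>2 \<le> 2 * (1 + C) * b * \<bar>e x\<bar>"
          by (metis abs_ge_zero mult_right_mono power2_abs power2_eq_square)
        moreover have "(f x)\<^sup>2 \<le> 2 * (\<psi> x - expectation \<psi>)\<^sup>2 + 2 * (e x)\<^sup>2"
          using square_sum_le_weighted[of 1 "\<psi> x - expectation \<psi>" "- e x"] f_eq by simp
        ultimately show ?case by linarith
      qed
    qed (use f2_int centred_int e_int in auto)
    also have "\<dots> = 2 * expectation (\<lambda>x. (\<psi> x - expectation \<psi>)\<^sup>2) + 4 * (1 + C) * b * expectation (\<lambda>x. \<bar>e x\<bar>)"
      using centred_int e_int by simp
    also have "\<dots> \<le> 2 * (b powr (2 - s) * ?M) + 4 * (1 + C) * b * \<eta>"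
      using variance approx b C unfolding e_def by (intro add_mono mult_left_mono) auto
    finally show ?thesis .
  qed

  note Z = maximal_inequality_exponential_decay[OF F f corr_int decay \<theta> n]
  have "expectation ?Z \<le> real (m + 1) *
      sqrt (2 ^ m * (real (2 * h + 1) * expectation (\<lambda>x. (f x)\<^sup>2) + 2 ^ m * (R * \<theta> ^ h)))"
    by (rule Z(2))
  also have "\<dots> \<le> real (m + 1) * sqrt (2 ^ m * (real (2 * h + 1) *
        (2 * (b powr (2 - s) * ?M) + 4 * (1 + C) * b * \<eta>) + 2 ^ m * (R * \<theta> ^ h)))"
    using f2_le by (intro mult_left_mono real_sqrt_le_mono add_right_mono) auto
  finally have Z_le: "expectation ?Z \<le> \<dots>" .

  have rF_int: "integrable M (\<lambda>x. \<bar>r ((F ^^ i) x)\<bar>)"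
    and rF: "expectation (\<lambda>x. \<bar>r ((F ^^ i) x)\<bar>) = expectation (\<lambda>x. \<bar>r x\<bar>)" for i
    using measure_preserving_integral[OF Fk, of "\<lambda>x. \<bar>r x\<bar>" i] r_int by auto
  let ?B = "\<lambda>x. \<Sum>i=1..n. \<bar>r ((F ^^ i) x)\<bar>"
  have "expectation ?B = real n * expectation (\<lambda>x. \<bar>r x\<bar>)"
    using rF_int rF by simp
  also have "\<dots> \<le> real n * (2 * (b powr (1 - s) * ?M) + \<eta>)"
    by (intro mult_left_mono r_le) simp
  finally have B_le: "expectation ?B \<le> \<dots>" .

  have Y_le: "\<bar>?Y x\<bar> \<le> ?Z x + ?B x" for x
    by (rule abs_Max_partial_sums_le[OF n(1)]) (simp add: r_def)
  have bound_int: "integrable M (\<lambda>x. ?Z x + ?B x)"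
    using Z(1) rF_int by simp
  show Y_int: "integrable M ?Y"
  proof (rule Bochner_Integration.integrable_bound[OF bound_int])
    show "?Y \<in> borel_measurable M" by measurable
    show "AE x in M. norm (?Y x) \<le> norm (?Z x + ?B x)"
      using Y_le by (auto intro!: AE_I2 order_trans[OF _ abs_ge_self])
  qed
  have "expectation (\<lambda>x. \<bar>?Y x\<bar>) \<le> expectation (\<lambda>x. ?Z x + ?B x)"
    using Y_int bound_int Y_le by (intro integral_mono) auto
  also have "\<dots> = expectation ?Z + expectation ?B"
    using Z(1) rF_int by (intro Bochner_Integration.integral_add) auto
  finally show "expectation (\<lambda>x. \<bar>?Y x\<bar>) \<le>
      real (m + 1) * sqrt (2 ^ m * (real (2 * h + 1) *
        (2 * (b powr (2 - s) * ?M) + 4 * (1 + C) * b * \<eta>) + 2 ^ m * (R * \<theta> ^ h))) +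
      real n * (2 * (b powr (1 - s) * ?M) + \<eta>)"
    using Z_le B_le by linarith
qed

section \<open>Asymptotics of the bound\<close>

lemma polylog_times_power_tendsto_0:
  fixes K q \<delta> c :: real
  assumes "\<delta> > 0" "q > 0" "K > 0"
  shows "(\<lambda>n::nat. (log 2 (real n) + 2) * sqrt (K * (2 * q * ln (real n) + 3) * real n powr (-\<delta>)) + c * real n powr (-\<delta>)) \<longlonglongrightarrow> 0"
proof -
  have 1: "(\<lambda>n::nat. (log 2 (real n) + 2) * sqrt (K * (2 * q * ln (real n) + 3) * real n powr (-\<delta>))) \<longlonglongrightarrow> 0"
    using assms by real_asymp
  have 2: "(\<lambda>n::nat. real n powr (-\<delta>)) \<longlonglongrightarrow> 0"
    using assms by real_asymp
  show ?thesis using tendsto_add[OF 1 tendsto_mult_left[OF 2, of c]] by simp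
qed

text \<open>
  The cutoff \<open>h\<close> is the least natural number with \<open>\<theta> ^ h \<le> n powr (- 2 * \<kappa> - 3)\<close>: this cancels
  the growth \<open>n powr (2 * \<kappa>)\<close> of the norms and the factor \<open>n\<^sup>2\<close> from the number of pairs, and leaves
  one more power of \<open>n\<close>. The depth \<open>m\<close> is the least one for which the dyadic interval covers \<open>n\<close>
  steps, so that \<open>2 ^ m\<close> is at most \<open>2 * n\<close>.
\<close>

lemma normalised_bound_le:
  fixes n :: nat and p s \<delta> M0 C D \<theta> \<kappa> \<eta> :: real
  assumes n: "1 \<le> n" and p: "0 < p" and \<delta>: "0 < \<delta>" "\<delta> \<le> 1" "\<delta> \<le> p * s - 1"
    and M0: "0 \<le> M0" and C: "0 \<le> C" and D: "0 \<le> D"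
    and \<theta>: "0 < \<theta>" "\<theta> < 1" and \<kappa>: "0 \<le> \<kappa>" and \<eta>: "0 \<le> \<eta>" "\<eta> \<le> C * real n powr (-4)"
  defines "b \<equiv> real n powr p" and "q \<equiv> (2 * \<kappa> + 3) / (- ln \<theta>)"
  defines "h \<equiv> nat \<lceil>q * ln (real n)\<rceil>" and "m \<equiv> nat \<lceil>log 2 (real n)\<rceil>"
  shows "n \<le> 2 ^ m"
    and "(real (m + 1) * sqrt (2 ^ m * (real (2 * h + 1) *
        (2 * (b powr (2 - s) * M0) + 4 * (1 + C) * b * \<eta>) + 2 ^ m * (D * real n powr (2 * \<kappa>) * \<theta> ^ h)))
      + real n * (2 * (b powr (1 - s) * M0) + \<eta>)) / b
      \<le> (log 2 (real n) + 2) * sqrt (2 * (2 * M0 + 4 * (1 + C) * C + 2 * D) *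
          (2 * q * ln (real n) + 3) * real n powr (-\<delta>))
        + (2 * M0 + C) * real n powr (-\<delta>)"
proof -
  define x where "x = real n"
  define u where "u = x powr (-\<delta>)"
  define H where "H = 2 * q * ln x + 3"
  define R where "R = D * x powr (2 * \<kappa>) * \<theta> ^ h"
  have x: "1 \<le> x" using n by (simp add: x_def)
  have b: "1 \<le> b" unfolding b_def using x p by (simp add: x_def ge_one_powr_ge_zero)
  have b_eq: "b = x powr p" by (simp add: b_def x_def)
  have u: "0 \<le> u" by (simp add: u_def)
  have ln\<theta>: "ln \<theta> < 0" using \<theta> by simp
  have q: "0 < q" unfolding q_def using ln\<theta> \<kappa> by (intro divide_pos_pos) auto
  have log_nn: "0 \<le> log 2 x" using x by simp
  have ln_nn: "0 \<le> q * ln x" using x q by simp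
  have m: "log 2 x \<le> real m" "real m \<le> log 2 x + 1"
    using log_nn by (auto simp: m_def x_def)
  have h_le: "real h \<le> q * ln x + 1"
    using ln_nn of_int_ceiling_le_add_one[of "q * ln x"] by (simp add: h_def x_def)
  have h: "q * ln x \<le> real h" "real (2 * h + 1) \<le> H"
    using h_le real_nat_ceiling_ge[of "q * ln x"] by (simp_all add: h_def x_def H_def)
  have H: "1 \<le> H" using ln_nn by (simp add: H_def)
  have "x = 2 powr log 2 x" using x by simp
  also have "\<dots> \<le> 2 powr real m" using m by (intro powr_mono) auto
  also have "\<dots> = 2 ^ m" by (simp add: powr_realpow)
  finally show "n \<le> 2 ^ m" unfolding x_def by (metis of_nat_le_iff of_nat_numeral of_nat_power)
  have "2 ^ m = 2 powr real m" by (simp add: powr_realpow)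
  also have "\<dots> \<le> 2 powr (log 2 x + 1)" using m by (intro powr_mono) auto
  also have "\<dots> = 2 * x" using x by (simp add: powr_add)
  finally have m2: "2 ^ m \<le> 2 * x" .

  have "\<theta> ^ h = \<theta> powr real h" using \<theta> by (simp add: powr_realpow)
  also have "\<dots> \<le> \<theta> powr (q * ln x)" using h \<theta> by (intro powr_mono') auto
  also have "\<dots> = x powr (- 2 * \<kappa> - 3)"
    using ln\<theta> \<theta> x by (simp add: powr_def q_def field_simps)
  finally have \<theta>h: "\<theta> ^ h \<le> x powr (- 2 * \<kappa> - 3)" .
  \<comment> \<open>Every term is compared with \<open>u * b powr z\<close>, where \<open>z\<close> is 0, 1 or 2; this reduces to exponents of \<open>x\<close>.\<close>
  have power_le: "x powr y \<le> u * b powr z" if "y \<le> p * z - \<delta>" for y z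
    using powr_mono[OF that x] x by (simp add: u_def b_eq powr_powr flip: powr_add)
  have b2: "b powr 2 = b\<^sup>2" and b1: "b powr 1 = b" and b0: "b powr 0 = 1" using b by auto

  have xb: "x * b powr z = x powr (1 + p * z)" for z
    using x by (simp add: b_eq powr_powr powr_add)
  have A1: "x * b powr (2 - s) \<le> u * b\<^sup>2"
    using power_le[of "1 + p * (2 - s)" 2] \<delta> unfolding xb b2 by (simp add: algebra_simps)
  have A2: "x * b powr (1 - s) \<le> u * b"
    using power_le[of "1 + p * (1 - s)" 1] \<delta> unfolding xb b1 by (simp add: algebra_simps)
  have B0: "x * \<eta> \<le> C * u"
  proof -
    have "x * \<eta> \<le> x * (C * x powr (-4))" using \<eta> x by (intro mult_left_mono) (auto simp: x_def)
    also have "\<dots> = C * x powr (-3)"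
      using x powr_add[of x 1 "-4"] by simp
    also have "\<dots> \<le> C * u"
      using power_le[of "-3" 0] \<delta> b0 C by (intro mult_left_mono) auto
    finally show ?thesis .
  qed
  have B2: "x * \<eta> \<le> C * u * b"
    using B0 mult_left_mono[of 1 b "C * u"] b C u by simp
  have B1: "x * (b * \<eta>) \<le> C * u * b\<^sup>2"
    using mult_right_mono[OF B2, of b] b by (simp add: power2_eq_square mult_ac)
  have C1: "x\<^sup>2 * R \<le> D * (u * b\<^sup>2)"
  proof -
    have "x\<^sup>2 * R \<le> x\<^sup>2 * (D * x powr (2 * \<kappa>) * x powr (- 2 * \<kappa> - 3))"
      unfolding R_def using \<theta>h D by (intro mult_left_mono) auto
    also have "\<dots> = D * x powr (2 + 2 * \<kappa> + (- 2 * \<kappa> - 3))"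
      unfolding powr_add using x by simp
    also have "\<dots> \<le> D * (u * b powr 2)"
      using power_le[of "-1" 2] \<delta> p D by (intro mult_left_mono) auto
    finally show ?thesis using b2 by simp
  qed
  have R: "0 \<le> R" unfolding R_def using D \<theta> by simp

  let ?K = "2 * (2 * M0 + 4 * (1 + C) * C + 2 * D)"
  let ?V = "2 ^ m * (real (2 * h + 1) * (2 * (b powr (2 - s) * M0) + 4 * (1 + C) * b * \<eta>) + 2 ^ m * R)"
  have "?V \<le> 2 * x * (H * (2 * (b powr (2 - s) * M0) + 4 * (1 + C) * b * \<eta>) + 2 * x * R)"
    using m2 h H b C M0 \<eta> R x
    by (intro mult_mono add_mono mult_right_mono add_nonneg_nonneg mult_nonneg_nonneg) auto
  also have "\<dots> = 2 * H * (2 * M0 * (x * b powr (2 - s)) + 4 * (1 + C) * (x * (b * \<eta>))) + 4 * (x\<^sup>2 * R)"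
    by (simp add: algebra_simps power2_eq_square)
  also have "\<dots> \<le> 2 * H * (2 * M0 * (u * b\<^sup>2) + 4 * (1 + C) * (C * u * b\<^sup>2)) + 4 * (D * (u * b\<^sup>2))"
    using A1 B1 C1 H M0 C by (intro add_mono mult_left_mono) auto
  also have "4 * (D * (u * b\<^sup>2)) \<le> H * (4 * (D * (u * b\<^sup>2)))"
    using mult_right_mono[OF H, of "4 * (D * (u * b\<^sup>2))"] D u by simp
  also have "2 * H * (2 * M0 * (u * b\<^sup>2) + 4 * (1 + C) * (C * u * b\<^sup>2)) + H * (4 * (D * (u * b\<^sup>2)))
      = ?K * H * u * b\<^sup>2"
    by (simp add: algebra_simps)
  finally have "sqrt ?V \<le> sqrt (?K * H * u * b\<^sup>2)" by simp
  also have "\<dots> = sqrt (?K * H * u) * b" using b by (simp add: real_sqrt_mult)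
  finally have sqrt_V: "sqrt ?V \<le> sqrt (?K * H * u) * b" .
  have "real (m + 1) * sqrt ?V \<le> (log 2 x + 2) * (sqrt (?K * H * u) * b)"
    using m log_nn sqrt_V by (intro mult_mono) (auto intro!: real_sqrt_ge_zero mult_nonneg_nonneg add_nonneg_nonneg simp: M0 C \<eta> R b_def)
  moreover have "x * (2 * (b powr (1 - s) * M0) + \<eta>) \<le> (2 * M0 + C) * u * b"
    using mult_left_mono[OF A2, of "2 * M0"] B2 M0 by (simp add: algebra_simps)
  ultimately have "(real (m + 1) * sqrt ?V + x * (2 * (b powr (1 - s) * M0) + \<eta>)) / b
      \<le> (log 2 x + 2) * sqrt (?K * H * u) + (2 * M0 + C) * u"
    using b by (simp add: field_simps)
  then show "(real (m + 1) * sqrt (2 ^ m * (real (2 * h + 1) *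
        (2 * (b powr (2 - s) * M0) + 4 * (1 + C) * b * \<eta>) + 2 ^ m * (D * real n powr (2 * \<kappa>) * \<theta> ^ h)))
      + real n * (2 * (b powr (1 - s) * M0) + \<eta>)) / b
      \<le> (log 2 (real n) + 2) * sqrt (2 * (2 * M0 + 4 * (1 + C) * C + 2 * D) *
          (2 * q * ln (real n) + 3) * real n powr (-\<delta>))
        + (2 * M0 + C) * real n powr (-\<delta>)"
    by (simp only: x_def R_def H_def u_def)
qed

section \<open>Convergence of the normalised maximum\<close>

lemma abs_truncation_le: "\<bar>truncation \<phi> \<alpha> \<epsilon> n x\<bar> \<le> real n powr (1 / \<alpha> + \<epsilon>)"
  by (auto simp: truncation_def indicator_def)

lemma (in prob_space) Linf_centred_truncation_le:
  assumes [measurable]: "\<phi> \<in> borel_measurable M"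
  shows "Linf_norm M (centred_truncation M \<phi> \<alpha> \<epsilon> n) \<le> ereal (2 * real n powr (1 / \<alpha> + \<epsilon>))"
proof -
  have trunc[measurable]: "truncation \<phi> \<alpha> \<epsilon> n \<in> borel_measurable M"
    unfolding truncation_def by measurable
  show ?thesis
    unfolding Linf_norm_def centred_truncation_def
    using abs_centred_le[OF trunc abs_truncation_le] by (intro esssup_I) auto
qed

lemma AE_abs_le_if_Linf_norm_le:
  assumes "Linf_norm M u \<le> ereal c"
  shows "AE x in M. \<bar>u x\<bar> \<le> c"
  using esssup_AE[of "\<lambda>x. ereal \<bar>u x\<bar>" M]
proof eventually_elim
  case (elim x)
  then show ?case using order_trans[OF _ assms[unfolded Linf_norm_def]] by fastforce
qed

lemma integral_abs_le_if_L1_norm_le: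
  assumes "integrable M u" and "L1_norm M u \<le> ennreal c" and "0 \<le> c"
  shows "(LINT x|M. \<bar>u x\<bar>) \<le> c"
  using assms nn_integral_eq_integral[of M "\<lambda>x. \<bar>u x\<bar>"]
  by (simp add: L1_norm_def)

theorem theorem11p2:
  fixes \<mu> :: "'x::{t2_space, second_countable_topology} measure"
    and F :: "'x \<Rightarrow> 'x"
    and A :: "('x, 'e::euclidean_space) chart set"
    and g :: "('x, 'e) chart \<Rightarrow> 'x \<Rightarrow> 'e \<Rightarrow> 'e \<Rightarrow> real"
    and B1 B2 :: "('x \<Rightarrow> real) set"
    and N1 N2 :: "('x \<Rightarrow> real) \<Rightarrow> real"
    and \<phi> :: "'x \<Rightarrow> real"
    and f :: "nat \<Rightarrow> 'x \<Rightarrow> real"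
    and \<alpha> \<epsilon> C \<kappa> :: real
    and D :: nat
  assumes "riemannian_manifold A g" and "DIM('e) = D"
    and "sets \<mu> = sets borel"
    and "ergodic_system \<mu> F"
    and "banach_function_space \<mu> B1 N1" and "banach_function_space \<mu> B2 N2"
    and "exp_decay_of_correlations \<mu> F B1 N1 B2 N2"
    and "1 < \<alpha>" and "\<alpha> < 2" and "has_stable_index \<mu> \<phi> \<alpha>"
    and "\<epsilon> > 0" and "C > 0" and "\<kappa> > 0"
    and "\<And>n. n \<ge> 1 \<Longrightarrow> f n \<in> B1 \<inter> B2"
    and a: "\<And>n. n \<ge> 1 \<Longrightarrow>
      L1_norm \<mu> (\<lambda>x. centred_truncation \<mu> \<phi> \<alpha> \<epsilon> n x - f n x) < ennreal (C * real n powr (- 4 - 1 / \<alpha>))"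
    and b: "\<And>n. n \<ge> 1 \<Longrightarrow> N1 (f n) < C * real n powr \<kappa>"
           "\<And>n. n \<ge> 1 \<Longrightarrow> N2 (f n) < C * real n powr \<kappa>"
    and c: "\<And>n. n \<ge> 1 \<Longrightarrow>
      Linf_norm \<mu> (f n) \<le> ereal C * Linf_norm \<mu> (centred_truncation \<mu> \<phi> \<alpha> \<epsilon> n)"
    and d: "\<And>n. n \<ge> 1 \<Longrightarrow> (LINT x|\<mu>. f n x) = 0"
  shows "converges_in_distribution_to_const \<mu>
    (\<lambda>n x. (MAX j\<in>{1..n}. \<Sum>i=1..j. (\<phi> ((F ^^ i) x) - (LINT y|\<mu>. \<phi> y))) / real n powr (1 / \<alpha> + \<epsilon>)) 0"
proof -
  interpret prob_space \<mu> using \<open>ergodic_system \<mu> F\<close> by (simp add: ergodic_system_def)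
  have F: "measure_preserving_map \<mu> F" using \<open>ergodic_system \<mu> F\<close> by (simp add: ergodic_system_def)
  have \<phi>_meas[measurable]: "\<phi> \<in> borel_measurable \<mu>"
    using \<open>has_stable_index \<mu> \<phi> \<alpha>\<close> by (simp add: has_stable_index_def)
  obtain C' \<theta> where C': "C' > 0" and \<theta>: "0 < \<theta>" "\<theta> < 1"
    and mixing: "\<And>f g n. f \<in> B1 \<Longrightarrow> g \<in> B2 \<Longrightarrow>
      integrable \<mu> f \<and> integrable \<mu> g \<and> integrable \<mu> (\<lambda>x. f x * g ((F ^^ n) x)) \<and>
      \<bar>(LINT x|\<mu>. f x * g ((F ^^ n) x)) - (LINT x|\<mu>. f x) * (LINT x|\<mu>. g x)\<bar>
        \<le> C' * \<theta> ^ n * N1 f * N2 g"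
    using \<open>exp_decay_of_correlations \<mu> F B1 N1 B2 N2\<close> unfolding exp_decay_of_correlations_def
    by blast
  define p where "p = 1 / \<alpha> + \<epsilon>"
  have p: "0 < p" using \<open>1 < \<alpha>\<close> \<open>\<epsilon> > 0\<close> by (simp add: p_def add_pos_pos)
  have "p * \<alpha> > 1" using \<open>1 < \<alpha>\<close> \<open>\<epsilon> > 0\<close> by (simp add: p_def field_simps)
  \<comment> \<open>A single \<open>s\<close> must give an integrable moment and make \<open>n * b powr (-s)\<close> a negative power of \<open>n\<close>.\<close>
  then have "max 1 (1 / p) < \<alpha>" using \<open>1 < \<alpha>\<close> p by (simp add: field_simps)
  then obtain s where s: "1 < s" "1 / p < s" "s < \<alpha>" using dense by (metis max_less_iff_conj)
  have ps: "p * s > 1" using s(2) p by (simp add: field_simps)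
  define \<delta> where "\<delta> = min 1 (p * s - 1)"
  have \<delta>: "0 < \<delta>" "\<delta> \<le> 1" "\<delta> \<le> p * s - 1" using ps by (auto simp: \<delta>_def)
  define M0 where "M0 = expectation (\<lambda>x. \<bar>\<phi> x\<bar> powr s)"
  have M0: "0 \<le> M0" by (simp add: M0_def)
  have moment: "integrable \<mu> (\<lambda>x. \<bar>\<phi> x\<bar> powr s)"
    using stable_index_moment[OF prob_space_axioms \<open>has_stable_index \<mu> \<phi> \<alpha>\<close>] s by simp
  define D' where "D' = C' * C\<^sup>2"
  have D': "D' > 0" using C' \<open>C > 0\<close> by (simp add: D'_def)
  define q where "q = (2 * \<kappa> + 3) / (- ln \<theta>)"
  have q: "q > 0" unfolding q_def using \<theta> \<open>\<kappa> > 0\<close> by (intro divide_pos_pos) auto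
  define K where "K = 2 * (2 * M0 + 4 * (1 + C) * C + 2 * D')"
  have K: "K > 0" unfolding K_def using M0 D' \<open>C > 0\<close> by (intro mult_pos_pos add_nonneg_pos) auto

  define Z where "Z = (\<lambda>n x. MAX j\<in>{1..n}. \<Sum>i=1..j. (\<phi> ((F ^^ i) x) - (LINT y|\<mu>. \<phi> y)))"
  have main: "integrable \<mu> (Z n) \<and> expectation (\<lambda>x. \<bar>Z n x\<bar>) / real n powr p \<le>
      (log 2 (real n) + 2) * sqrt (K * (2 * q * ln (real n) + 3) * real n powr (-\<delta>))
      + (2 * M0 + C) * real n powr (-\<delta>)" if n: "1 \<le> n" for n
  proof -
    define b where "b = real n powr p"
    define h where "h = nat \<lceil>q * ln (real n)\<rceil>"
    define m where "m = nat \<lceil>log 2 (real n)\<rceil>"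
    define \<eta> where "\<eta> = C * real n powr (- 4 - 1 / \<alpha>)"
    have b_pos: "0 < b" using n by (simp add: b_def)
    have \<eta>: "0 \<le> \<eta>" "\<eta> \<le> C * real n powr (-4)"
      using \<open>C > 0\<close> \<open>1 < \<alpha>\<close> n by (auto simp: \<eta>_def intro!: powr_mono)
    have fB: "f n \<in> B1" "f n \<in> B2" using assms(14)[OF n] by auto
    define \<psi> where "\<psi> = (\<lambda>x. \<phi> x * indicator {y. \<bar>y\<bar> < b} (\<phi> x))"
    have trunc: "truncation \<phi> \<alpha> \<epsilon> n = \<psi>"
      by (rule ext) (simp add: truncation_def \<psi>_def b_def p_def indicator_def)
    have \<psi>_int: "integrable \<mu> \<psi>"
      using abs_truncation_le[of \<phi> \<alpha> \<epsilon> n] unfolding trunc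
      by (intro integrable_const_bound[where B = b]) (auto simp: b_def p_def \<psi>_def)
    have f_int: "integrable \<mu> (f n)" using mixing[OF fB] by simp
    have f_bound: "AE x in \<mu>. \<bar>f n x\<bar> \<le> C * (2 * b)"
    proof (rule AE_abs_le_if_Linf_norm_le)
      have "Linf_norm \<mu> (f n) \<le> ereal C * Linf_norm \<mu> (centred_truncation \<mu> \<phi> \<alpha> \<epsilon> n)"
        by (rule c[OF n])
      also have "\<dots> \<le> ereal C * ereal (2 * b)"
        using Linf_centred_truncation_le[OF \<phi>_meas, of \<alpha> \<epsilon> n] \<open>C > 0\<close>
        by (intro ereal_mult_left_mono) (auto simp: b_def p_def)
      finally show "Linf_norm \<mu> (f n) \<le> ereal (C * (2 * b))" by simp
    qed
    have approx: "expectation (\<lambda>x. \<bar>\<psi> x - expectation \<psi> - f n x\<bar>) \<le> \<eta>"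
    proof (rule integral_abs_le_if_L1_norm_le)
      show "integrable \<mu> (\<lambda>x. \<psi> x - expectation \<psi> - f n x)" using \<psi>_int f_int by simp
      show "L1_norm \<mu> (\<lambda>x. \<psi> x - expectation \<psi> - f n x) \<le> ennreal \<eta>"
        using a[OF n] by (simp add: centred_truncation_def trunc \<eta>_def)
    qed (rule \<eta>(1))
    have corr_int: "integrable \<mu> (\<lambda>x. f n x * f n ((F ^^ k) x))" for k
      using mixing[OF fB] by simp
    have decay: "\<bar>expectation (\<lambda>x. f n x * f n ((F ^^ k) x))\<bar> \<le> D' * real n powr (2 * \<kappa>) * \<theta> ^ k" for k
    proof -
      have "0 \<le> N1 (f n)" "0 \<le> N2 (f n)"
        using \<open>banach_function_space \<mu> B1 N1\<close> \<open>banach_function_space \<mu> B2 N2\<close> fB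
        by (auto simp: banach_function_space_def)
      then have "N1 (f n) * N2 (f n) \<le> (C * real n powr \<kappa>) * (C * real n powr \<kappa>)"
        using b[OF n] by (intro mult_mono) auto
      also have "\<dots> = C\<^sup>2 * real n powr (2 * \<kappa>)"
        using n by (simp add: power2_eq_square flip: powr_add)
      finally have "C' * \<theta> ^ k * (N1 (f n) * N2 (f n)) \<le> C' * \<theta> ^ k * (C\<^sup>2 * real n powr (2 * \<kappa>))"
        using C' \<theta> by (intro mult_left_mono) auto
      moreover have "\<bar>expectation (\<lambda>x. f n x * f n ((F ^^ k) x))\<bar> \<le> C' * \<theta> ^ k * N1 (f n) * N2 (f n)"
        using mixing[OF fB, of k] d[OF n] by simp
      ultimately show ?thesis by (simp add: D'_def mult_ac)
    qed
    note numeric = normalised_bound_le[OF n p \<delta> M0 less_imp_le[OF \<open>C > 0\<close>] less_imp_le[OF D'] \<theta>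
      less_imp_le[OF \<open>\<kappa> > 0\<close>] \<eta>, folded q_def, folded b_def h_def m_def K_def]
    have s': "1 \<le> s" "s \<le> 2" using s \<open>\<alpha> < 2\<close> by auto
    note bound = truncated_maximal_inequality[OF F \<phi>_meas moment s' b_pos f_int f_bound
      less_imp_le[OF \<open>C > 0\<close>] approx[unfolded \<psi>_def] corr_int decay \<theta> n numeric(1), folded M0_def]
    have "expectation (\<lambda>x. \<bar>Z n x\<bar>) / b \<le> (log 2 (real n) + 2) *
        sqrt (K * (2 * q * ln (real n) + 3) * real n powr (-\<delta>)) + (2 * M0 + C) * real n powr (-\<delta>)"
      unfolding Z_def
      by (rule order_trans[OF divide_right_mono[OF bound(2)[where h = h]] numeric(2)])
        (use b_pos in simp)
    then show ?thesis using bound(1) unfolding b_def Z_def by simp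
  qed

  define Y where "Y = (\<lambda>n x. Z n x / real n powr p)"
  \<comment> \<open>At \<open>n = 0\<close> the denominator is \<open>0 powr p = 0\<close>, so \<open>Y 0\<close> is the zero function.\<close>
  have Y_int: "integrable \<mu> (Y n)" for n
    using main[of n] by (cases n) (auto simp: Y_def)
  have "converges_in_distribution_to_const \<mu> Y 0"
  proof (rule converges_in_distribution_to_const_if_L1)
    show "Y n \<in> borel_measurable \<mu>" for n using Y_int by simp
    show "integrable \<mu> (\<lambda>x. \<bar>Y n x - 0\<bar>)" for n using Y_int by simp
    show "(\<lambda>n. expectation (\<lambda>x. \<bar>Y n x - 0\<bar>)) \<longlonglongrightarrow> 0"
    proof (rule tendsto_sandwich[OF _ _ tendsto_const])
      show "\<forall>\<^sub>F n in sequentially. expectation (\<lambda>x. \<bar>Y n x - 0\<bar>) \<le>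
          (log 2 (real n) + 2) * sqrt (K * (2 * q * ln (real n) + 3) * real n powr (-\<delta>))
          + (2 * M0 + C) * real n powr (-\<delta>)"
        by (rule eventually_sequentiallyI[of 1]) (use main in \<open>simp add: Y_def\<close>)
      show "(\<lambda>n. (log 2 (real n) + 2) * sqrt (K * (2 * q * ln (real n) + 3) * real n powr (-\<delta>))
          + (2 * M0 + C) * real n powr (-\<delta>)) \<longlonglongrightarrow> 0"
        by (rule polylog_times_power_tendsto_0[OF \<delta>(1) q K])
    qed simp
  qed
  then show ?thesis unfolding Y_def Z_def p_def .
qed

end
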